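(* Let $g,h$ be arithmetic functions with $g(1)=1$ and $0<h(n)\le h(n+1)$ for all $n\ge 1$, put $h(0):=0$, and let $P_n^{g,h}(x)$ be the associated polynomials. Let $0<\varepsilon<1$. Assume that the power series $$G_1(T)=\sum_{k=1}^{\infty}|g(k+1)|\,T^k$$ has radius of convergence $R>0$ (possibly $R=\infty$). Let $0<T_\varepsilon<R$ be such that $G_1(T_\varepsilon)\le\varepsilon$, and put $\kappa=\kappa_\varepsilon=\frac{1}{1-\varepsilon}\frac{1}{T_\varepsilon}$. Then for all $n\ge 1$ and all $x\in\mathbb{C}$ with $|x|>\kappa\,h(n-1)$, $$\left|P_n^{g,h}(x)-\frac{x}{h(n)}P_{n-1}^{g,h}(x)\right|<\varepsilon\,\frac{|x|}{h(n)}\left|P_{n-1}^{g,h}(x)\right|.$$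
   Context: An arithmetic function is a function on the positive integers; $g$ is complex-valued and $h$ is real-valued. The polynomials $P_n^{g,h}(x)$ are defined by $P_0^{g,h}(x)=1$ and, for $n\ge1$, $$P_n^{g,h}(x)=\frac{x}{h(n)}\sum_{k=1}^{n}g(k)\,P_{n-k}^{g,h}(x).$$ *)

theory Defs
  imports "HOL-Analysis.Analysis"
begin

text \<open>
  Arithmetic functions are rendered as functions on \<^typ>\<open>nat\<close>. The value \<open>g 0\<close> is never
  used; the value \<open>h 0\<close> does not enter the recursion.
\<close>

function P_poly :: "(nat \<Rightarrow> complex) \<Rightarrow> (nat \<Rightarrow> real) \<Rightarrow> nat \<Rightarrow> complex poly" where
  "P_poly g h 0 = 1"
| "n \<ge> 1 \<Longrightarrow> P_poly g h n =
     smult (1 / of_real (h n)) ([:0, 1:] * (\<Sum>k = 1..n. smult (g k) (P_poly g h (n - k))))"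
proof -
  fix Q and x :: "(nat \<Rightarrow> complex) \<times> (nat \<Rightarrow> real) \<times> nat"
  assume zero: "\<And>g h. x = (g, h, 0) \<Longrightarrow> Q"
    and pos: "\<And>n g h. n \<ge> 1 \<Longrightarrow> x = (g, h, n) \<Longrightarrow> Q"
  obtain g h n where "x = (g, h, n)" by (cases x)
  with zero pos show Q by (cases "n = 0") auto
qed auto
termination by (relation "Wellfounded.measure (\<lambda>(g, h, n). n)") auto

definition G1 :: "(nat \<Rightarrow> complex) \<Rightarrow> real fps" where
  "G1 g = Abs_fps (\<lambda>k. if k = 0 then 0 else norm (g (k + 1)))"

end

theory Submission
  imports Defs
begin

text \<open>
  Strong induction on \<open>n\<close>. If the estimate holds for all indices \<open>m < n\<close>, then
  \<open>|P\<^sub>m(x)| > (1 - \<epsilon>) |x| / h(m) |P\<^sub>m\<^sub>-\<^sub>1(x)|\<close>, and \<open>|x| > \<kappa> h(n - 1) \<ge> \<kappa> h(m)\<close> turns this into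
  \<open>|P\<^sub>m\<^sub>-\<^sub>1(x)| < T |P\<^sub>m(x)|\<close>. Iterating, \<open>|P\<^sub>n\<^sub>-\<^sub>1\<^sub>-\<^sub>j(x)| < T\<^sup>j |P\<^sub>n\<^sub>-\<^sub>1(x)|\<close>, so the terms
  \<open>k \<ge> 2\<close> of the recursion add up to less than \<open>|x| / h(n) G\<^sub>1(T) |P\<^sub>n\<^sub>-\<^sub>1(x)|\<close>.
\<close>

text \<open>Since \<open>g 1 = 1\<close>, the subtracted term is exactly the summand
  \<open>k = 1\<close> of the recursion. The shift \<open>k = j + 1\<close> lines the remaining
  weights up with the coefficients of \<open>G1 g\<close>.\<close>

lemma poly_P_poly_diff:
  assumes "g 1 = 1" "n \<ge> 1"
  shows "poly (P_poly g h n) x - x / of_real (h n) * poly (P_poly g h (n - 1)) x =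
    x / of_real (h n) * (\<Sum>j\<in>{1..<n}. g (Suc j) * poly (P_poly g h (n - 1 - j)) x)"
proof -
  have "poly (P_poly g h n) x = x / of_real (h n) * (\<Sum>k=1..n. g k * poly (P_poly g h (n - k)) x)"
    using assms(2) by (simp add: poly_sum)
  also have "(\<Sum>k=1..n. g k * poly (P_poly g h (n - k)) x) =
      (\<Sum>j\<in>{0..<n}. g (Suc j) * poly (P_poly g h (n - 1 - j)) x)"
    by (rule sum.reindex_bij_witness[of _ Suc "\<lambda>k. k - 1"]) auto
  also have "\<dots> = poly (P_poly g h (n - 1)) x +
      (\<Sum>j\<in>{1..<n}. g (Suc j) * poly (P_poly g h (n - 1 - j)) x)"
    using assms by (subst sum.atLeast_Suc_lessThan) auto
  finally show ?thesis
    by (simp add: algebra_simps)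
qed

text \<open>A finite part of a convergent series with nonnegative terms is at most its sum.\<close>

lemma sum_G1_le_eval:
  assumes "0 < T" "ereal T < fps_conv_radius (G1 g)"
  shows "(\<Sum>j\<in>{1..<n}. norm (g (Suc j)) * T ^ j) \<le> eval_fps (G1 g) T"
proof -
  have "summable (\<lambda>j. fps_nth (G1 g) j * T ^ j)"
    using assms by (intro summable_fps) simp
  then have "(\<Sum>j\<in>{1..<n}. fps_nth (G1 g) j * T ^ j) \<le> eval_fps (G1 g) T"
    unfolding eval_fps_def using assms(1)
    by (intro sum_le_suminf) (auto simp: G1_def)
  moreover have "(\<Sum>j\<in>{1..<n}. fps_nth (G1 g) j * T ^ j) = (\<Sum>j\<in>{1..<n}. norm (g (Suc j)) * T ^ j)"
    by (intro sum.cong) (auto simp: G1_def)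
  ultimately show ?thesis by simp
qed

lemma growth_iterate:
  fixes a :: "nat \<Rightarrow> real"
  assumes "\<And>m. 1 \<le> m \<Longrightarrow> m \<le> N \<Longrightarrow> a (m - 1) < T * a m" "0 < T" "1 \<le> j" "j \<le> N"
  shows "a (N - j) < T ^ j * a N"
  using assms(3,4)
proof (induction j rule: dec_induct)
  case base
  then show ?case using assms(1)[of N] by simp
next
  case (step j)
  have "a (N - Suc j) < T * a (N - j)"
    using assms(1)[of "N - j"] step by simp
  also have "\<dots> < T * (T ^ j * a N)"
    using step assms(2) by simp
  finally show ?case by (simp add: mult.assoc)
qed

text \<open>One positive weight makes the comparison with \<open>c\<close> strict. If all weights
  vanish, or \<open>A\<close> is empty as for \<open>n = 1\<close> below, strictness comes from
  \<open>0 < C\<close> instead.\<close>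

lemma sum_weights_less:
  fixes w b c :: "'a \<Rightarrow> real"
  assumes "finite A" "\<And>i. i \<in> A \<Longrightarrow> 0 \<le> w i" "\<And>i. i \<in> A \<Longrightarrow> b i < c i"
    and "(\<Sum>i\<in>A. w i * c i) \<le> C" "0 < C"
  shows "(\<Sum>i\<in>A. w i * b i) < C"
proof (cases "\<forall>i\<in>A. w i = 0")
  case True
  then show ?thesis using assms(5) by simp
next
  case False
  then obtain i where "i \<in> A" "0 < w i"
    using assms(2) by (metis order_le_less)
  then have "(\<Sum>i\<in>A. w i * b i) < (\<Sum>i\<in>A. w i * c i)"
    using assms(1-3)
    by (intro sum_strict_mono_ex1) (auto intro!: mult_left_mono bexI[of _ i] simp: less_imp_le)
  then show ?thesis using assms(4) by simp
qed

theorem theorem1: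
  fixes g :: "nat \<Rightarrow> complex" and h :: "nat \<Rightarrow> real"
    and \<epsilon> T \<kappa> :: real and R :: ereal
  assumes "g 1 = 1"
    and "\<And>n. n \<ge> 1 \<Longrightarrow> 0 < h n \<and> h n \<le> h (n + 1)"
    and "h 0 = 0"
    and "0 < \<epsilon>" and "\<epsilon> < 1"
    and "R = fps_conv_radius (G1 g)" and "R > 0"
    and "0 < T" and "ereal T < R"
    and "eval_fps (G1 g) T \<le> \<epsilon>"
    and "\<kappa> = 1 / (1 - \<epsilon>) * (1 / T)"
  shows "\<forall>n\<ge>1. \<forall>x::complex. norm x > \<kappa> * h (n - 1) \<longrightarrow>
    norm (poly (P_poly g h n) x - x / of_real (h n) * poly (P_poly g h (n - 1)) x)
      < \<epsilon> * (norm x / h n) * norm (poly (P_poly g h (n - 1)) x)"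
proof -
  have h_pos: "0 < h n" if "n \<ge> 1" for n
    using assms(2) that by blast
  \<comment> \<open>The convention \<open>h 0 = 0\<close> extends monotonicity down to index
    0.\<close>
  have "h n \<le> h (Suc n)" for n
    using assms(2)[of n] h_pos[of 1] assms(3) by (cases "n = 0") auto
  then have h_mono: "h m \<le> h n" if "m \<le> n" for m n
    using that by (rule lift_Suc_mono_le)
  have \<kappa>_pos: "0 < \<kappa>"
    using assms(5,8,11) by simp
  have main: "norm (poly (P_poly g h n) x - x / of_real (h n) * poly (P_poly g h (n - 1)) x)
      < \<epsilon> * (norm x / h n) * norm (poly (P_poly g h (n - 1)) x)"
    if "n \<ge> 1" "norm x > \<kappa> * h (n - 1)" for n x
    using that
  proof (induction n rule: less_induct)
    case (less n)
    define p where "p m = poly (P_poly g h m) x" for m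
    have x_gt: "norm x > \<kappa> * h m" if "m \<le> n - 1" for m
      using less.prems(2) h_mono[OF that] \<kappa>_pos
      by (meson le_less_trans less_imp_le mult_left_mono)
    \<comment> \<open>At \<open>m = 0\<close> the bound reads \<open>norm x > 0\<close>, because
      \<open>h 0 = 0\<close>.\<close>
    have x_pos: "0 < norm x"
      using x_gt[of 0] assms(3) by simp
    have growth: "norm (p (m - 1)) < T * norm (p m)" if m: "1 \<le> m" "m \<le> n - 1" for m
    proof -
      define r where "r = norm x / h m"
      have r_pos: "0 < r"
        using x_pos h_pos m(1) by (simp add: r_def)
      have IH: "norm (p m - x / of_real (h m) * p (m - 1)) < \<epsilon> * r * norm (p (m - 1))"
        using less.IH[of m] m x_gt[of "m - 1"] by (simp add: p_def r_def)
      have "norm (x / of_real (h m) * p (m - 1)) = r * norm (p (m - 1))"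
        using h_pos[OF m(1)] by (simp add: r_def norm_mult norm_divide)
      then have "r * norm (p (m - 1)) - norm (p m) \<le> norm (p m - x / of_real (h m) * p (m - 1))"
        by (metis norm_minus_commute norm_triangle_ineq2)
      with IH have "(1 - \<epsilon>) * r * norm (p (m - 1)) < norm (p m)"
        by (simp add: algebra_simps)
      then have "T * ((1 - \<epsilon>) * r * norm (p (m - 1))) < T * norm (p m)"
        using assms(8) by simp
      \<comment> \<open>This fixes the choice of \<open>\<kappa>\<close>:
        \<open>norm x > \<kappa> * h m\<close> says \<open>r > 1 / ((1 - \<epsilon>) * T)\<close>.
        The weak form is enough, as \<open>IH\<close> already supplies strictness.\<close>
      moreover have "1 \<le> T * ((1 - \<epsilon>) * r)"
        using x_gt[OF m(2)] h_pos[OF m(1)] assms(5,8)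
        by (simp add: r_def assms(11) field_simps)
      then have "norm (p (m - 1)) \<le> T * ((1 - \<epsilon>) * r) * norm (p (m - 1))"
        using mult_right_mono[of 1 _ "norm (p (m - 1))"] by simp
      ultimately show ?thesis by (simp add: mult.assoc)
    qed
    have p_pos: "0 < norm (p (n - 1))"
    proof (cases "n = 1")
      case True
      then show ?thesis by (simp add: p_def)
    next
      case False
      \<comment> \<open>Growth at \<open>m = n - 1\<close> places this product strictly above a
        norm, which excludes a zero of \<open>P_poly g h (n - 1)\<close> at
        \<open>x\<close>.\<close>
      then have "0 < T * norm (p (n - 1))"
        using less.prems(1) by (intro le_less_trans[OF norm_ge_zero growth]) auto
      then show ?thesis using assms(8) by (simp add: zero_less_mult_iff)
    qed
    have "(\<Sum>j\<in>{1..<n}. norm (g (Suc j)) * norm (p (n - 1 - j))) < \<epsilon> * norm (p (n - 1))"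
    proof (rule sum_weights_less[where c = "\<lambda>j. T ^ j * norm (p (n - 1))"])
      show "norm (p (n - 1 - j)) < T ^ j * norm (p (n - 1))" if "j \<in> {1..<n}" for j
        using growth_iterate[of "n - 1" "\<lambda>m. norm (p m)" T j] growth assms(8) that
        by fastforce
      have "(\<Sum>j\<in>{1..<n}. norm (g (Suc j)) * T ^ j) \<le> \<epsilon>"
        using sum_G1_le_eval[of T g n] assms(6,8-10) by simp
      then show "(\<Sum>j\<in>{1..<n}. norm (g (Suc j)) * (T ^ j * norm (p (n - 1)))) \<le> \<epsilon> * norm (p (n - 1))"
        by (simp add: mult.assoc[symmetric] sum_distrib_right[symmetric] mult_right_mono)
    qed (use p_pos assms(4) in auto)
    then have "norm (\<Sum>j\<in>{1..<n}. g (Suc j) * p (n - 1 - j)) < \<epsilon> * norm (p (n - 1))"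
      by (intro le_less_trans[OF norm_sum]) (simp add: norm_mult)
    \<comment> \<open>The factor is positive by \<open>x_pos\<close>, so strictness
      survives.\<close>
    then have "norm x / h n * norm (\<Sum>j\<in>{1..<n}. g (Suc j) * p (n - 1 - j))
        < norm x / h n * (\<epsilon> * norm (p (n - 1)))"
      using x_pos h_pos[OF less.prems(1)] by (intro mult_strict_left_mono) auto
    then show ?case
      unfolding poly_P_poly_diff[where g = g, OF assms(1) less.prems(1)] p_def
      using h_pos[OF less.prems(1)]
      by (simp add: norm_mult norm_divide mult_ac)
  qed
  then show ?thesis by blast
qed

end
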